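(* Let $G=(V,E,w)$ be an $n$-vertex weighted undirected graph (with arbitrary aspect ratio), and let $k,h\in[n]=\{1,\dots,n\}$. Then there is a distribution $\mathcal{D}$ over pairs $(U,M)$, where $U$ is a dominating ultrametric with $V$ as leaves and $M\subseteq V$ (so $M$ is a random variable), such that every $(U,M)$ in the support of $\mathcal{D}$ has Ramsey hop-distortion $(O(k\cdot\log\log n),M,O(k\cdot\log\log n),h)$, and for every $v\in V$, $\Pr_{(U,M)\sim\mathcal{D}}[v\in M]\ge\Omega(n^{-1/k})$. In addition, for every $\epsilon\in(0,1)$, there is a distribution $\mathcal{D}$ over such pairs such that every $(U,M)$ in the support has Ramsey hop-distortion $\left(O(\frac{\log n\cdot\log\log n}{\epsilon}),M,O(\frac{\log n\cdot\log\log n}{\epsilon}),h\right)$, and for every $v\in V$, $\Pr[v\in M]\ge1-\epsilon$.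
   Context: Graphs are undirected with finite positive edge weights. For $h\in\mathbb{N}$, $d_G^{(h)}(u,v)$ is the minimum weight of a $u$-$v$ path in $G$ with at most $h$ edges (hops), and $d_G^{(h)}(u,v)=\infty$ if no such path exists. Constants hidden in $O(\cdot)$, $\Omega(\cdot)$ are universal, and (iterated) logarithmic factors inside $O(\cdot)$ are understood to be at least $1$. An ultrametric is a metric space with $d(x,z)\le\max\{d(x,y),d(y,z)\}$ for all $x,y,z$; equivalently (HST) its points are the leaves of a rooted tree with node labels $\ell\ge0$, where labels are non-increasing from the root to the leaves, are $0$ exactly at the leaves, and the distance between two leaves is the label of their least common ancestor. The value $\infty$ is allowed as a distance/label in the ultrametrics. $U$ is dominating if $d_G(u,v)\le d_U(u,v)$ for all $u,v\in V$. An ultrametric $U$ over $V$ has Ramsey hop-distortion $(t,M,\beta,h)$, where $M\subseteq V$, if $d_G^{(\beta\cdot h)}(u,v)\le d_U(u,v)$ for all $u,v\in V$, and $d_U(u,v)\le t\cdot d_G^{(h)}(u,v)$ for all $u\in M$, $v\in V$. When $\beta\cdot h$ is not an integer it may be rounded down. *)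

theory Defs
  imports "HOL-Probability.Probability"
begin

text \<open>
  Undirected weighted graphs, not necessarily connected; an edge is the two-element set of its
  endpoints.
\<close>

locale weighted_graph =
  fixes V :: "'a set" and E :: "'a set set" and w :: "'a set \<Rightarrow> real"
  assumes finite_vertices: "finite V"
    and edge_subset: "e \<in> E \<Longrightarrow> e \<subseteq> V"
    and edge_card: "e \<in> E \<Longrightarrow> card e = 2"
    and weight_pos: "e \<in> E \<Longrightarrow> 0 < w e"

fun path_edges :: "'a list \<Rightarrow> 'a set list" where
  "path_edges (x # y # zs) = {x, y} # path_edges (y # zs)"
| "path_edges _ = []"

definition path_between :: "'a set \<Rightarrow> 'a set set \<Rightarrow> 'a \<Rightarrow> 'a list \<Rightarrow> 'a \<Rightarrow> bool" where
  "path_between V E u p v \<longleftrightarrow>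
     p \<noteq> [] \<and> hd p = u \<and> last p = v \<and> distinct p \<and> set p \<subseteq> V \<and> set (path_edges p) \<subseteq> E"

definition path_weight :: "('a set \<Rightarrow> real) \<Rightarrow> 'a list \<Rightarrow> real" where
  "path_weight w p = sum_list (map w (path_edges p))"

text \<open>
  Both infima range over finite sets of paths, hence are minima, and are \<open>\<infinity>\<close> if there is no path.
\<close>

definition graph_dist :: "'a set \<Rightarrow> 'a set set \<Rightarrow> ('a set \<Rightarrow> real) \<Rightarrow> 'a \<Rightarrow> 'a \<Rightarrow> ennreal" where
  "graph_dist V E w u v = (INF p \<in> {p. path_between V E u p v}. ennreal (path_weight w p))"

definition hop_dist :: "'a set \<Rightarrow> 'a set set \<Rightarrow> ('a set \<Rightarrow> real) \<Rightarrow> nat \<Rightarrow> 'a \<Rightarrow> 'a \<Rightarrow> ennreal" where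
  "hop_dist V E w h u v =
     (INF p \<in> {p. path_between V E u p v \<and> length (path_edges p) \<le> h}. ennreal (path_weight w p))"

text \<open>
  Ultrametrics on \<open>V\<close> may take the value \<open>\<infinity>\<close>, so the real-valued metric spaces of the library do
  not apply. Values outside \<open>V\<close> are irrelevant.
\<close>

definition ultrametric_on :: "'a set \<Rightarrow> ('a \<Rightarrow> 'a \<Rightarrow> ennreal) \<Rightarrow> bool" where
  "ultrametric_on V U \<longleftrightarrow>
     (\<forall>x\<in>V. \<forall>y\<in>V. U x y = 0 \<longleftrightarrow> x = y) \<and>
     (\<forall>x\<in>V. \<forall>y\<in>V. U x y = U y x) \<and>
     (\<forall>x\<in>V. \<forall>y\<in>V. \<forall>z\<in>V. U x z \<le> max (U x y) (U y z))"

definition dominating ::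
  "'a set \<Rightarrow> 'a set set \<Rightarrow> ('a set \<Rightarrow> real) \<Rightarrow> ('a \<Rightarrow> 'a \<Rightarrow> ennreal) \<Rightarrow> bool" where
  "dominating V E w U \<longleftrightarrow> (\<forall>u\<in>V. \<forall>v\<in>V. graph_dist V E w u v \<le> U u v)"

definition ramsey_hop_distortion ::
  "'a set \<Rightarrow> 'a set set \<Rightarrow> ('a set \<Rightarrow> real) \<Rightarrow> ('a \<Rightarrow> 'a \<Rightarrow> ennreal) \<Rightarrow>
   real \<Rightarrow> 'a set \<Rightarrow> real \<Rightarrow> nat \<Rightarrow> bool" where
  "ramsey_hop_distortion V E w U t M \<beta> h \<longleftrightarrow>
     M \<subseteq> V \<and>
     (\<forall>u\<in>V. \<forall>v\<in>V. hop_dist V E w (nat \<lfloor>\<beta> * real h\<rfloor>) u v \<le> U u v) \<and>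
     (\<forall>u\<in>M. \<forall>v\<in>V. U u v \<le> ennreal t * hop_dist V E w h u v)"

text \<open>
  Logarithmic factors in asymptotic bounds are understood to be at least 1. The choice of the base
  only affects the constants.
\<close>

definition lg :: "real \<Rightarrow> real" where
  "lg x = max 1 (log 2 x)"

end

theory Submission imports Defs
begin

text \<open>
  At scale \<open>\<Delta>\<close> call two vertices adjacent if their \<open>h\<close>-hop distance is at most \<open>\<Delta>\<close>. Balls of
  radius \<open>s\<close> in this relation have hop radius \<open>s * h\<close> and weighted radius \<open>s * \<Delta>\<close>, so clusters
  of adjacency radius \<open>O(J)\<close> at all scales \<open>\<Delta> = 2 ^ i * a\<close>, refining each other as \<open>\<Delta>\<close> decreases,
  give an ultrametric with the required lower bound; the upper bound holds at every vertex that is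
  never separated from its neighbours. Since the hop budget is the same at every scale, volumes of
  balls do not telescope as in a metric space. Instead a cluster with set \<open>Y\<close> of surviving vertices
  is cut around a ball \<open>B\<close> at a radius where the growth rate of \<open>B\<close> is at most
  \<open>(\<nu> Y / \<nu> B) powr (1 / \<kappa>)\<close>. Until \<open>B\<close> has half of the mass, every failing radius shrinks
  \<open>ln (\<nu> Y / \<nu> B)\<close> by the factor \<open>1 - 1 / \<kappa>\<close>, so \<open>J = O(\<kappa> * ln ln W)\<close> radii suffice, where \<open>W\<close>
  bounds the total weight; this is the source of the iterated logarithm. The charges telescope
  and the survivors have mass at least \<open>\<nu> Y powr (1 - 1 / \<kappa>)\<close>. As this is possible for every
  weight function \<open>\<nu>\<close>, a minimax argument yields the distribution.
\<close>

section \<open>Sparse cuts by ball growing\<close>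

lemma sym_relpow:
  assumes "sym R"
  shows "sym (R ^^ s)"
proof (induction s)
  case (Suc s)
  then show ?case using assms
    by (metis converse_relcomp relpow.simps(2) relpow_commute sym_conv_converse_eq)
qed (auto simp: sym_def)

text \<open>
  Either the ball around some \<open>v\<close> stays below half of the mass up to radius \<open>2 * J\<close>, and then
  the logarithm of the ratio between total mass and ball mass, which must shrink by the factor
  \<open>1 - 1 / \<kappa>\<close> at each failing radius, has no room; or any two balls of radius \<open>2 * J\<close>
  meet, and a ball of radius \<open>4 * J\<close> already contains \<open>Y\<close>.
\<close>
lemma exists_sparse_cut:
  fixes \<nu> :: "'a \<Rightarrow> real" and R :: "('a \<times> 'a) set"
  assumes "finite Y" "Y \<noteq> {}" and R: "sym R" "\<And>y. y \<in> Y \<Longrightarrow> (y, y) \<in> R"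
    and \<nu>: "\<And>y. y \<in> Y \<Longrightarrow> 1 \<le> \<nu> y" "sum \<nu> Y \<le> W"
    and \<kappa>: "1 \<le> \<kappa>" and J: "exp (- real J / \<kappa>) * ln W < ln 2"
  shows "\<exists>v\<in>Y. \<exists>s\<le>4 * J. 0 < sum \<nu> (Y \<inter> (R ^^ s) `` {v}) \<and>
     sum \<nu> (Y \<inter> (R ^^ (s + 2)) `` {v})
       \<le> sum \<nu> (Y \<inter> (R ^^ s) `` {v}) * (sum \<nu> Y / sum \<nu> (Y \<inter> (R ^^ s) `` {v})) powr (1 / \<kappa>)"
proof -
  define m where "m v s = sum \<nu> (Y \<inter> (R ^^ s) `` {v})" for v s
  have refl: "(y, y) \<in> R ^^ s" if "y \<in> Y" for y s
    using R(2)[OF that] by (induction s) auto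
  have m1: "1 \<le> m v s" if v: "v \<in> Y" for v s
  proof -
    have "1 \<le> \<nu> v" using \<nu> v by auto
    also have "\<nu> v \<le> m v s" unfolding m_def
      by (rule member_le_sum) (use v refl assms(1) in \<open>auto dest!: \<nu>(1)\<close>)
    finally show ?thesis .
  qed
  have mle: "m v s \<le> sum \<nu> Y" for v s
    unfolding m_def by (rule sum_mono2) (use assms(1) in \<open>auto dest!: \<nu>(1)\<close>)
  have Y1: "1 \<le> sum \<nu> Y" using assms(2) m1 mle by (meson all_not_in_conv order_trans)
  show ?thesis
  proof (cases "\<exists>v\<in>Y. m v (2 * J) \<le> sum \<nu> Y / 2")
    case True
    then obtain v where v: "v \<in> Y" "m v (2 * J) \<le> sum \<nu> Y / 2" by blast
    define b where "b j = ln (sum \<nu> Y / m v (2 * j))" for j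
    \<comment> \<open>Only even radii are tried, so that consecutive attempts abut: a failure at
      \<open>2 * j\<close> bounds from below the mass at the next radius
      \<open>2 * j + 2\<close>.\<close>
    have "\<exists>j<J. m v (2 * j + 2) \<le> m v (2 * j) * (sum \<nu> Y / m v (2 * j)) powr (1 / \<kappa>)"
    proof (rule ccontr)
      assume "\<not> ?thesis"
      then have fail: "m v (2 * j) * (sum \<nu> Y / m v (2 * j)) powr (1 / \<kappa>) < m v (2 * j + 2)" if "j < J" for j
        using that by force
      have "b j \<le> (1 - 1 / \<kappa>) ^ j * ln W" if "j \<le> J" for j
        using that
      proof (induction j)
        case 0
        have "sum \<nu> Y / m v 0 \<le> W / 1"
          using m1[OF v(1), of 0] \<nu>(2) Y1 by (intro frac_le) auto
        moreover have "0 < sum \<nu> Y / m v 0" using Y1 m1[OF v(1), of 0] by (intro divide_pos_pos) auto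
        ultimately have "ln (sum \<nu> Y / m v 0) \<le> ln W" by (subst ln_le_cancel_iff) auto
        then show ?case by (simp add: b_def)
      next
        case (Suc j)
        have pos: "0 < m v (2 * j)" "0 < m v (2 * j + 2)" "0 < sum \<nu> Y"
          using m1[OF v(1), of "2 * j"] m1[OF v(1), of "2 * j + 2"] Y1 by linarith+
        have "ln (m v (2 * j) * (sum \<nu> Y / m v (2 * j)) powr (1 / \<kappa>)) < ln (m v (2 * j + 2))"
          using fail[of j] Suc.prems pos by (subst ln_less_cancel_iff) auto
        then have "ln (m v (2 * j)) + b j / \<kappa> < ln (m v (2 * j + 2))"
          using pos by (simp add: ln_mult ln_powr b_def)
        moreover have "b (Suc j) = ln (sum \<nu> Y) - ln (m v (2 * j + 2))"
          "b j = ln (sum \<nu> Y) - ln (m v (2 * j))"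
          using pos by (simp_all add: b_def ln_div)
        ultimately have "b (Suc j) \<le> b j - b j / \<kappa>" by linarith
        then have "b (Suc j) \<le> (1 - 1 / \<kappa>) * b j" by (simp add: left_diff_distrib)
        also have "\<dots> \<le> (1 - 1 / \<kappa>) * ((1 - 1 / \<kappa>) ^ j * ln W)"
          using Suc \<kappa> by (intro mult_left_mono) auto
        finally show ?case by simp
      qed
      then have "b J \<le> (1 - 1 / \<kappa>) ^ J * ln W" by blast
      \<comment> \<open>This is \<open>1 - x \<le> exp (- x)\<close> at
        \<open>x = 1 / \<kappa>\<close>; it brings the bound into the form of assumption
        \<open>J\<close>.\<close>
      also have "\<dots> \<le> exp (- (1 / \<kappa>)) ^ J * ln W"
        using exp_ge_add_one_self[of "- (1 / \<kappa>)"] \<kappa> Y1 \<nu>(2)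
        by (intro mult_right_mono power_mono) auto
      also have "\<dots> = exp (- real J / \<kappa>) * ln W" by (simp flip: exp_of_nat_mult)
      finally have "b J < ln 2" using J by simp
      \<comment> \<open>The ball of radius \<open>2 * J\<close> has at most half of the mass, so the
        ratio inside \<open>b J\<close> is at least 2.\<close>
      moreover have "ln 2 \<le> b J"
        unfolding b_def using v(2) m1[OF v(1), of "2 * J"] Y1
        by (subst ln_le_cancel_iff) (auto simp: field_simps)
      ultimately show False by simp
    qed
    then obtain j where "j < J" "m v (2 * j + 2) \<le> m v (2 * j) * (sum \<nu> Y / m v (2 * j)) powr (1 / \<kappa>)"
      by blast
    then show ?thesis using v(1) m1[OF v(1), of "2 * j"] unfolding m_def
      by (intro bexI[of _ v] exI[of _ "2 * j"]) auto
  next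
    case False
    obtain v where v: "v \<in> Y" using assms(2) by blast
    have "Y \<subseteq> (R ^^ (4 * J)) `` {v}"
    proof
      fix y assume y: "y \<in> Y"
      let ?A = "Y \<inter> (R ^^ (2 * J)) `` {v}" and ?B = "Y \<inter> (R ^^ (2 * J)) `` {y}"
      \<comment> \<open>Disjoint balls would together exceed the total, since each has more than
        half of it.\<close>
      have "?A \<inter> ?B \<noteq> {}"
      proof
        assume "?A \<inter> ?B = {}"
        then have "sum \<nu> (?A \<union> ?B) = m v (2 * J) + m y (2 * J)"
          unfolding m_def using assms(1) by (intro sum.union_disjoint) auto
        moreover have "sum \<nu> (?A \<union> ?B) \<le> sum \<nu> Y"
          by (rule sum_mono2) (use assms(1) in \<open>auto dest!: \<nu>(1)\<close>)
        moreover have "sum \<nu> Y / 2 < m v (2 * J)" "sum \<nu> Y / 2 < m y (2 * J)"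
          using False v y by force+
        ultimately show False by linarith
      qed
      then obtain z where "(v, z) \<in> R ^^ (2 * J)" "(y, z) \<in> R ^^ (2 * J)" by blast
      then have "(v, y) \<in> R ^^ (2 * J + 2 * J)"
        using sym_relpow[OF R(1), of "2 * J"] unfolding relpow_add by (blast dest: symD)
      then show "y \<in> (R ^^ (4 * J)) `` {v}" by simp
    qed
    \<comment> \<open>With the whole mass inside, the ratio is 1 and further growth is impossible,
      so the cut inequality is trivial at \<open>s = 4 * J\<close>.\<close>
    then have "m v (4 * J) = sum \<nu> Y" unfolding m_def by (simp add: Int_absorb2)
    then show ?thesis using v mle[of v "4 * J + 2"] Y1 unfolding m_def
      by (intro bexI[of _ v] exI[of _ "4 * J"]) auto
  qed
qed

section \<open>From guarantees for every weight function to a distribution\<close>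

text \<open>A potential argument. The potential sums the squared amounts by which vertices lag
  behind the target frequency \<open>p\<close>. Choosing the next element by \<open>F\<close> with
  the shortfalls \<open>r\<close> as weights makes the linear term of the change nonpositive. The
  quadratic term is at most 1 per vertex, because a shortfall moves by \<open>p\<close> or
  \<open>p - 1\<close>.\<close>

lemma exists_frequent_list:
  fixes F :: "'b set" and sel :: "'b \<Rightarrow> 'a set" and p :: real
  assumes "finite V" "0 \<le> p" "p \<le> 1"
    and F: "\<And>\<mu> :: 'a \<Rightarrow> real. (\<And>v. 0 \<le> \<mu> v) \<Longrightarrow> \<exists>x\<in>F. p * sum \<mu> V \<le> sum \<mu> (V \<inter> sel x)"
  shows "\<exists>xs. length xs = T \<and> set xs \<subseteq> F \<and>
    (\<Sum>v\<in>V. (max 0 (p * T - length (filter (\<lambda>x. v \<in> sel x) xs)))\<^sup>2) \<le> card V * T"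
proof (induction T)
  case 0
  then show ?case by simp
next
  case (Suc T)
  then obtain xs where xs: "length xs = T" "set xs \<subseteq> F"
    "(\<Sum>v\<in>V. (max 0 (p * T - length (filter (\<lambda>x. v \<in> sel x) xs)))\<^sup>2) \<le> card V * T" by blast
  define r where "r v = max 0 (p * T - length (filter (\<lambda>x. v \<in> sel x) xs))" for v
  have "\<exists>x\<in>F. p * sum r V \<le> sum r (V \<inter> sel x)" by (rule F) (simp add: r_def)
  then obtain x where x: "x \<in> F" "p * sum r V \<le> sum r (V \<inter> sel x)" by blast
  define d :: "'a \<Rightarrow> real" where "d v = p - (if v \<in> sel x then 1 else 0)" for v
  have "(\<Sum>v\<in>V. r v * d v) = p * sum r V - (\<Sum>v\<in>V. if v \<in> sel x then r v else 0)"
    unfolding sum_distrib_left sum_subtractf[symmetric]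
    by (rule sum.cong) (auto simp: d_def algebra_simps)
  also have "(\<Sum>v\<in>V. if v \<in> sel x then r v else 0) = sum r (V \<inter> sel x)"
    using assms(1) by (simp add: sum.inter_restrict)
  finally have cross: "(\<Sum>v\<in>V. r v * d v) \<le> 0" using x by simp
  have step: "(max 0 (p * Suc T - length (filter (\<lambda>x. v \<in> sel x) (x # xs))))\<^sup>2 \<le> (r v)\<^sup>2 + 2 * (r v * d v) + 1" for v
  proof -
    have eq: "p * Suc T - length (filter (\<lambda>x. v \<in> sel x) (x # xs))
        = (p * T - length (filter (\<lambda>x. v \<in> sel x) xs)) + d v"
      by (simp add: d_def algebra_simps)
    have "(max 0 (a + d v))\<^sup>2 \<le> (max 0 a)\<^sup>2 + 2 * (max 0 a * d v) + 1" for a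
    proof -
      \<comment> \<open>Either the left side is 0, or
        \<open>0 < a + d v \<le> max 0 a + d v\<close>.\<close>
      have "(max 0 (a + d v))\<^sup>2 \<le> (max 0 a + d v)\<^sup>2"
        by (cases "a + d v \<le> 0") (auto intro!: power_mono simp: max_def)
      also have "\<dots> = (max 0 a)\<^sup>2 + 2 * (max 0 a * d v) + (d v)\<^sup>2"
        by (simp add: power2_sum)
      also have "(d v)\<^sup>2 \<le> 1" using assms(2,3) by (auto simp: d_def abs_square_le_1)
      finally show ?thesis by simp
    qed
    then show ?thesis unfolding eq r_def .
  qed
  have "(\<Sum>v\<in>V. (max 0 (p * Suc T - length (filter (\<lambda>x. v \<in> sel x) (x # xs))))\<^sup>2)
      \<le> (\<Sum>v\<in>V. (r v)\<^sup>2 + 2 * (r v * d v) + 1)"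
    by (intro sum_mono step)
  also have "\<dots> = (\<Sum>v\<in>V. (r v)\<^sup>2) + 2 * (\<Sum>v\<in>V. r v * d v) + card V"
    by (simp add: sum.distrib sum_distrib_left)
  also have "\<dots> \<le> card V * Suc T" using xs(3) cross unfolding r_def by (simp add: algebra_simps)
  finally show ?case using xs x by (intro exI[of _ "x # xs"]) auto
qed

text \<open>
  An approximate form of von Neumann's minimax theorem: repeatedly playing an element that is good
  against the current shortfalls keeps the sum of their squares linear in the number of rounds.
\<close>
lemma exists_covering_pmf:
  fixes F :: "'b set" and sel :: "'b \<Rightarrow> 'a set" and p \<delta> :: real
  assumes "finite V" "0 \<le> p" "p \<le> 1" "0 < \<delta>"
    and F: "\<And>\<mu> :: 'a \<Rightarrow> real. (\<And>v. 0 \<le> \<mu> v) \<Longrightarrow> \<exists>x\<in>F. p * sum \<mu> V \<le> sum \<mu> (V \<inter> sel x)"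
  shows "\<exists>D. set_pmf D \<subseteq> F \<and> (\<forall>v\<in>V. p - \<delta> \<le> measure_pmf.prob D {x. v \<in> sel x})"
proof -
  \<comment> \<open>A single shortfall is at most the root of the potential,
    \<open>sqrt (card V * T)\<close>; this \<open>T\<close> makes it at most
    \<open>\<delta> * T\<close>, hence at most \<open>\<delta>\<close> per round.\<close>
  obtain T :: nat where T: "real (card V) / \<delta>\<^sup>2 < T" using reals_Archimedean2 by blast
  have T0: "0 < real T" using T by (rule le_less_trans[rotated]) simp
  obtain xs where xs: "length xs = T" "set xs \<subseteq> F"
    "(\<Sum>v\<in>V. (max 0 (p * T - length (filter (\<lambda>x. v \<in> sel x) xs)))\<^sup>2) \<le> card V * T"
    using exists_frequent_list[OF assms(1-3) F] by blast
  \<comment> \<open>Uniform over rounds rather than over elements, so that repeated choices count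
    with their multiplicity.\<close>
  define D where "D = map_pmf (nth xs) (pmf_of_set {..<T})"
  have ne: "{..<T} \<noteq> {}" "finite {..<T}" using T0 by auto
  have "set_pmf D \<subseteq> F" using xs(1,2) ne by (auto simp: D_def dest: nth_mem)
  moreover have "p - \<delta> \<le> measure_pmf.prob D {x. v \<in> sel x}" if v: "v \<in> V" for v
  proof -
    define N where "N = real (length (filter (\<lambda>x. v \<in> sel x) xs))"
    have "measure_pmf.prob D {x. v \<in> sel x} = card ({..<T} \<inter> nth xs -` {x. v \<in> sel x}) / card {..<T}"
      using ne by (simp add: D_def measure_pmf_of_set)
    also have "{..<T} \<inter> nth xs -` {x. v \<in> sel x} = {i. i < length xs \<and> v \<in> sel (xs ! i)}"
      using xs(1) by auto
    finally have prob: "measure_pmf.prob D {x. v \<in> sel x} = N / T"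
      by (simp add: N_def length_filter_conv_card)
    have "(max 0 (p * T - N))\<^sup>2 \<le> (\<Sum>v\<in>V. (max 0 (p * T - length (filter (\<lambda>x. v \<in> sel x) xs)))\<^sup>2)"
      unfolding N_def by (rule member_le_sum) (use v assms(1) in auto)
    also have "\<dots> \<le> card V * T" by (rule xs)
    also have "real (card V * T) \<le> (\<delta>\<^sup>2 * T) * T"
      using T T0 assms(4) unfolding of_nat_mult by (intro mult_right_mono) (auto simp: field_simps)
    also have "\<dots> = (\<delta> * T)\<^sup>2" by (simp add: power2_eq_square)
    finally have "max 0 (p * T - N) \<le> \<delta> * T"
      using assms(4) T0 by (auto dest: power2_le_imp_le)
    then show ?thesis unfolding prob using T0 by (simp add: field_simps)
  qed
  ultimately show ?thesis by blast
qed

section \<open>Paths and hop-bounded distances\<close>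

lemma path_edges_append:
  "path_edges (xs @ y # ys) = path_edges (xs @ [y]) @ path_edges (y # ys)"
proof (induction xs)
  case (Cons x xs)
  then show ?case by (cases xs) auto
qed simp

lemma path_edges_rev: "path_edges (rev p) = rev (path_edges p)"
proof (induction p rule: path_edges.induct)
  case (1 x y zs)
  have "path_edges (rev (x # y # zs)) = path_edges (rev zs @ y # [x])" by simp
  also have "\<dots> = path_edges (rev (y # zs)) @ [{x, y}]"
    by (subst path_edges_append) (simp add: insert_commute)
  finally show ?case using 1 by simp
qed auto

lemma path_weight_rev: "path_weight w (rev p) = path_weight w p"
  by (simp add: path_weight_def path_edges_rev rev_map[symmetric])

lemma path_between_rev: "path_between V E u p v \<Longrightarrow> path_between V E v (rev p) u"
  by (auto simp: path_between_def path_edges_rev hd_rev last_rev)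

context weighted_graph
begin

lemma path_weight_nonneg: "set (path_edges p) \<subseteq> E \<Longrightarrow> 0 \<le> path_weight w p"
  unfolding path_weight_def by (intro sum_list_nonneg) (auto intro: less_imp_le weight_pos)

text \<open>Paths must be \<open>distinct\<close>, but gluing two of them, as in the triangle
  inequality, may repeat vertices. Cutting out the closed part between two occurrences of a vertex
  increases neither hops nor weight, since weights are positive.\<close>

lemma walk_shortcut:
  assumes "p \<noteq> []" "set p \<subseteq> V" "set (path_edges p) \<subseteq> E"
  shows "\<exists>q. path_between V E (hd p) q (last p) \<and> length (path_edges q) \<le> length (path_edges p)
           \<and> path_weight w q \<le> path_weight w p"
  using assms
proof (induction p rule: length_induct)
  case (1 p)
  show ?case
  proof (cases "distinct p")
    case True
    with 1 show ?thesis by (auto simp: path_between_def)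
  next
    case False
    then obtain xs y ys zs where p: "p = xs @ [y] @ ys @ [y] @ zs"
      using not_distinct_decomp by blast
    define q where "q = xs @ y # zs"
    have pe: "path_edges p = path_edges (xs @ [y]) @ path_edges (y # ys @ [y]) @ path_edges (y # zs)"
      using path_edges_append[of xs y "ys @ y # zs"] path_edges_append[of "y # ys" y zs] by (simp add: p)
    have qe: "path_edges q = path_edges (xs @ [y]) @ path_edges (y # zs)"
      unfolding q_def by (rule path_edges_append)
    have "length q < length p" "q \<noteq> []" "set q \<subseteq> V" "set (path_edges q) \<subseteq> E"
      using 1 pe qe by (auto simp: p q_def)
    moreover have "hd q = hd p" "last q = last p" by (auto simp: p q_def hd_append)
    moreover have "0 \<le> path_weight w (y # ys @ [y])"
      using 1 pe by (intro path_weight_nonneg) auto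
    then have "path_weight w q \<le> path_weight w p"
      by (simp add: path_weight_def pe qe)
    moreover have "length (path_edges q) \<le> length (path_edges p)"
      by (simp add: pe qe)
    ultimately show ?thesis using 1(1) by (metis order_trans)
  qed
qed

lemma hop_dist_le:
  assumes "path_between V E u p v" "length (path_edges p) \<le> h"
  shows "hop_dist V E w h u v \<le> ennreal (path_weight w p)"
  unfolding hop_dist_def by (rule INF_lower) (use assms in auto)

lemma hop_dist_attained:
  assumes "hop_dist V E w h u v < \<top>"
  obtains p where "path_between V E u p v" "length (path_edges p) \<le> h"
    "hop_dist V E w h u v = ennreal (path_weight w p)"
proof -
  let ?P = "{p. path_between V E u p v \<and> length (path_edges p) \<le> h}"
  have "?P \<subseteq> {p. set p \<subseteq> V \<and> distinct p}" by (auto simp: path_between_def)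
  then have "finite ?P"
    using finite_subset_distinct[OF finite_vertices] by (rule finite_subset)
  moreover have "?P \<noteq> {}"
  proof
    assume "?P = {}"
    then show False using assms unfolding hop_dist_def by (metis INF_empty less_irrefl)
  qed
  ultimately have "(INF p\<in>?P. ennreal (path_weight w p)) \<in> (\<lambda>p. ennreal (path_weight w p)) ` ?P"
    by (subst cInf_eq_Min) (auto intro!: Min_in)
  then show thesis unfolding hop_dist_def using that[unfolded hop_dist_def] by auto
qed

lemma hop_dist_self: "u \<in> V \<Longrightarrow> hop_dist V E w h u u = 0"
  using hop_dist_le[of u "[u]" u h] by (simp add: path_between_def path_weight_def)

lemma hop_dist_commute: "hop_dist V E w h u v = hop_dist V E w h v u"
proof -
  have le: "hop_dist V E w h u v \<le> hop_dist V E w h v u" for u v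
    unfolding hop_dist_def
    by (rule INF_mono)
      (metis (no_types, lifting) mem_Collect_eq length_rev path_between_rev path_edges_rev path_weight_rev order_refl)
  then show ?thesis by (simp add: antisym)
qed

lemma hop_dist_mono: "a \<le> b \<Longrightarrow> hop_dist V E w b u v \<le> hop_dist V E w a u v"
  unfolding hop_dist_def by (rule INF_superset_mono) auto

lemma graph_dist_le_hop_dist: "graph_dist V E w u v \<le> hop_dist V E w h u v"
  unfolding hop_dist_def graph_dist_def by (rule INF_superset_mono) auto

lemma hop_dist_triangle:
  "hop_dist V E w (a + b) x z \<le> hop_dist V E w a x y + hop_dist V E w b y z"
proof (cases "hop_dist V E w a x y < \<top> \<and> hop_dist V E w b y z < \<top>")
  case True
  then obtain p q where p: "path_between V E x p y" "length (path_edges p) \<le> a"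
      "hop_dist V E w a x y = ennreal (path_weight w p)"
    and q: "path_between V E y q z" "length (path_edges q) \<le> b"
      "hop_dist V E w b y z = ennreal (path_weight w q)"
    by (metis hop_dist_attained)
  obtain p' where p': "p = p' @ [y]"
    using p(1) unfolding path_between_def by (metis append_butlast_last_id)
  obtain q' where q': "q = y # q'"
    using q(1) unfolding path_between_def by (metis list.collapse)
  define r where "r = p' @ y # q'"
  have re: "path_edges r = path_edges p @ path_edges q"
    unfolding r_def p' q' by (rule path_edges_append)
  have "r \<noteq> []" "set r \<subseteq> V" "set (path_edges r) \<subseteq> E"
    using p(1) q(1) re by (auto simp: path_between_def r_def p' q')
  from walk_shortcut[OF this] obtain s where s: "path_between V E (hd r) s (last r)"
    "length (path_edges s) \<le> length (path_edges r)" "path_weight w s \<le> path_weight w r" by blast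
  have "hd r = x" "last r = z"
    using p(1) q(1) by (auto simp: path_between_def r_def p' q' hd_append split: if_splits)
  with s re p q have "hop_dist V E w (a + b) x z \<le> ennreal (path_weight w s)"
    by (intro hop_dist_le) auto
  also have "\<dots> \<le> ennreal (path_weight w r)" using s by (simp add: ennreal_leI)
  also have "\<dots> = ennreal (path_weight w p + path_weight w q)" by (simp add: path_weight_def re)
  also have "\<dots> = hop_dist V E w a x y + hop_dist V E w b y z"
    using p(1) q(1) by (simp add: p(3) q(3) ennreal_plus path_weight_nonneg path_between_def)
  finally show ?thesis .
qed (auto simp: less_top[symmetric])

text \<open>A path between different vertices contains an edge, which alone weighs more than
  \<open>a\<close>. This provides the finest scale, where no two vertices are adjacent.\<close>

lemma hop_dist_small_imp_eq:
  assumes "\<And>e. e \<in> E \<Longrightarrow> a < w e" "0 \<le> a" "hop_dist V E w h u v \<le> ennreal a"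
  shows "u = v"
proof (rule ccontr)
  assume "u \<noteq> v"
  have "hop_dist V E w h u v < \<top>" using assms(3) by (metis ennreal_less_top le_less_trans)
  then obtain p where p: "path_between V E u p v" "hop_dist V E w h u v = ennreal (path_weight w p)"
    by (metis hop_dist_attained)
  obtain x y zs where xyz: "p = x # y # zs"
    using p(1) \<open>u \<noteq> v\<close> unfolding path_between_def
    by (metis last.simps list.sel(1) list.exhaust)
  have E: "{x, y} \<in> E" "set (path_edges (y # zs)) \<subseteq> E"
    using p(1) by (auto simp: path_between_def xyz)
  have "a < w {x, y}" using E assms(1) by blast
  also have "\<dots> \<le> path_weight w p"
    using path_weight_nonneg[OF E(2)] by (simp add: path_weight_def xyz)
  finally show False using assms(2,3) p(2) by (simp add: ennreal_le_iff2)
qed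

lemma finite_edges: "finite E"
  by (rule finite_subset[of _ "Pow V"]) (auto simp: finite_vertices dest: edge_subset)

text \<open>A crude bound: at most \<open>card V\<close> edges, each of at most the total edge
  weight. It provides a coarsest scale, at which all finite distances are covered.\<close>

lemma hop_dist_bounded:
  assumes "hop_dist V E w h u v < \<top>"
  shows "hop_dist V E w h u v \<le> ennreal (card V * (\<Sum>e\<in>E. w e))"
proof -
  obtain p where p: "path_between V E u p v" "hop_dist V E w h u v = ennreal (path_weight w p)"
    using assms by (metis hop_dist_attained)
  have len: "length (path_edges q) \<le> length q" for q :: "'a list"
    by (induction q rule: path_edges.induct) auto
  have S: "0 \<le> (\<Sum>e\<in>E. w e)" by (intro sum_nonneg) (auto intro: less_imp_le weight_pos)
  have "path_weight w p \<le> (\<Sum>e\<leftarrow>path_edges p. (\<Sum>e\<in>E. w e))"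
    unfolding path_weight_def using p(1)
    by (intro sum_list_mono member_le_sum)
      (auto simp: path_between_def finite_edges intro: less_imp_le weight_pos)
  also have "\<dots> = length (path_edges p) * (\<Sum>e\<in>E. w e)" by (simp add: sum_list_triv)
  also have "\<dots> \<le> card V * (\<Sum>e\<in>E. w e)"
  proof (rule mult_right_mono[OF _ S])
    have "length p = card (set p)" using p(1) by (simp add: path_between_def distinct_card)
    also have "\<dots> \<le> card V" using p(1) finite_vertices by (auto simp: path_between_def intro: card_mono)
    finally show "real (length (path_edges p)) \<le> card V" using len[of p] by linarith
  qed
  finally show ?thesis using p(2) by (simp add: ennreal_leI)
qed

section \<open>Ultrametrics that are correct up to a scale\<close>

text \<open>The invariant of the induction over scales. The upper bound is promised only for pairs
  within \<open>\<Delta>\<close>, so vertices separated so far may be at distance \<infinity>.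
  Distances are those of the whole graph: connecting paths may leave the cluster
  \<open>X\<close>.\<close>

definition ramsey_below ::
  "nat \<Rightarrow> nat \<Rightarrow> real \<Rightarrow> 'a set \<Rightarrow> ('a \<Rightarrow> 'a \<Rightarrow> ennreal) \<Rightarrow> 'a set \<Rightarrow> bool" where
  "ramsey_below b h \<Delta> X U M \<longleftrightarrow>
     ultrametric_on X U \<and> M \<subseteq> X \<and>
     (\<forall>u\<in>X. \<forall>v\<in>X. hop_dist V E w (b * h) u v \<le> U u v) \<and>
     (\<forall>u\<in>M. \<forall>v\<in>X. hop_dist V E w h u v \<le> ennreal \<Delta> \<longrightarrow>
        U u v \<le> ennreal (2 * b) * hop_dist V E w h u v)"

text \<open>Serves at the finest scale, and with \<open>M = {}\<close> for a cluster in which no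
  survivors are left.\<close>

lemma ramsey_below_discrete:
  assumes "X \<subseteq> V" "M \<subseteq> X"
    and "\<And>u v. u \<in> M \<Longrightarrow> v \<in> X \<Longrightarrow> hop_dist V E w h u v \<le> ennreal \<Delta> \<Longrightarrow> u = v"
  shows "ramsey_below b h \<Delta> X (\<lambda>u v. if u = v then 0 else \<top>) M"
  unfolding ramsey_below_def
proof (intro conjI ballI impI)
  show "ultrametric_on X (\<lambda>u v. if u = v then 0 else \<top>)"
    unfolding ultrametric_on_def by auto
  show "M \<subseteq> X" by (rule assms(2))
next
  fix u v assume "u \<in> X" "v \<in> X"
  then show "hop_dist V E w (b * h) u v \<le> (if u = v then 0 else \<top>)"
    using assms(1) by (auto simp: hop_dist_self)
next
  fix u v assume "u \<in> M" "v \<in> X" "hop_dist V E w h u v \<le> ennreal \<Delta>"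
  then have "u = v" by (rule assms(3))
  then show "(if u = v then 0 else \<top>) \<le> ennreal (2 * b) * hop_dist V E w h u v" by simp
qed

text \<open>Capping preserves the ultrametric inequality, and \<open>diam\<close> says that the cap
  respects the lower bound. A pair newly within the scale is more than \<open>\<Delta>\<close>
  apart, so the cap \<open>b * (2 * \<Delta>)\<close> is at most \<open>2 * b\<close> times its
  distance; this is where the factor 2 in the distortion arises.\<close>

lemma ramsey_below_double:
  assumes U: "ramsey_below b h \<Delta> X U M" and "0 < \<Delta>" "0 < b"
    and diam: "\<And>u v. u \<in> X \<Longrightarrow> v \<in> X \<Longrightarrow> hop_dist V E w (b * h) u v \<le> ennreal (b * (2 * \<Delta>))"
  shows "ramsey_below b h (2 * \<Delta>) X (\<lambda>u v. min (U u v) (ennreal (b * (2 * \<Delta>)))) M"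
proof -
  define t where "t = ennreal (b * (2 * \<Delta>))"
  have t: "0 < t" unfolding t_def using assms(2,3) by (simp add: ennreal_zero_less_mult_iff)
  have "ultrametric_on X U" using U unfolding ramsey_below_def by (rule conjunct1)
  note UM = this[unfolded ultrametric_on_def]
  have um: "ultrametric_on X (\<lambda>u v. min (U u v) t)"
    unfolding ultrametric_on_def
  proof (intro conjI ballI)
    fix x y assume xy: "x \<in> X" "y \<in> X"
    show "min (U x y) t = 0 \<longleftrightarrow> x = y"
    proof -
      have "U x y = 0 \<longleftrightarrow> x = y" using UM xy by blast
      then show ?thesis using t by (auto simp: min_def)
    qed
    show "min (U x y) t = min (U y x) t"
      using UM xy by simp
    fix z assume "z \<in> X"
    then have "U x z \<le> max (U x y) (U y z)"
      using UM xy by simp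
    then show "min (U x z) t \<le> max (min (U x y) t) (min (U y z) t)"
      by (auto simp: min_def max_def split: if_splits)
  qed
  have "min (U u v) t \<le> ennreal (2 * b) * hop_dist V E w h u v"
    if "u \<in> M" "v \<in> X" for u v
  proof (cases "hop_dist V E w h u v \<le> ennreal \<Delta>")
    case True
    then have "U u v \<le> ennreal (2 * b) * hop_dist V E w h u v"
      using U that unfolding ramsey_below_def by blast
    then show ?thesis by (rule min.coboundedI1)
  next
    case False
    have "t = ennreal (2 * b) * ennreal \<Delta>"
      unfolding t_def using assms(2) by (subst ennreal_mult[symmetric]) (auto simp: algebra_simps)
    also have "\<dots> \<le> ennreal (2 * b) * hop_dist V E w h u v"
      using False by (intro mult_left_mono) auto
    finally show ?thesis by (rule min.coboundedI2)
  qed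
  then show ?thesis
    using U um diam unfolding ramsey_below_def t_def by simp
qed

text \<open>The two sides are put at distance \<infinity>. This harms no survivor, as none is within
  \<open>\<Delta>\<close> of a vertex on the other side.\<close>

lemma ramsey_below_union:
  assumes A: "ramsey_below b h \<Delta> A U M" and B: "ramsey_below b h \<Delta> B U' M'" and "A \<inter> B = {}"
    and "\<And>u v. u \<in> M \<Longrightarrow> v \<in> B \<Longrightarrow> \<not> hop_dist V E w h u v \<le> ennreal \<Delta>"
    and "\<And>u v. u \<in> M' \<Longrightarrow> v \<in> A \<Longrightarrow> \<not> hop_dist V E w h u v \<le> ennreal \<Delta>"
  shows "ramsey_below b h \<Delta> (A \<union> B)
    (\<lambda>u v. if u \<in> A \<and> v \<in> A then U u v else if u \<in> B \<and> v \<in> B then U' u v else \<top>) (M \<union> M')"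
    (is "ramsey_below _ _ _ _ ?U _")
proof -
  have disj: "x \<notin> B" if "x \<in> A" for x using assms(3) that by blast
  have um: "ultrametric_on A U" "ultrametric_on B U'"
    using A B unfolding ramsey_below_def by auto
  have "ultrametric_on (A \<union> B) ?U"
    unfolding ultrametric_on_def
  proof (intro conjI ballI)
    fix x y assume xy: "x \<in> A \<union> B" "y \<in> A \<union> B"
    show "?U x y = 0 \<longleftrightarrow> x = y"
      using xy um disj unfolding ultrametric_on_def by auto
    show "?U x y = ?U y x"
      using xy um disj unfolding ultrametric_on_def by auto
    fix z assume "z \<in> A \<union> B"
    then show "?U x z \<le> max (?U x y) (?U y z)"
      using xy um disj unfolding ultrametric_on_def by auto
  qed
  then show ?thesis
    using A B assms(4,5) disj unfolding ramsey_below_def by (auto simp: subset_iff)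
qed

section \<open>Clustering scale by scale\<close>

lemma hop_dist_relpow:
  assumes "(x, y) \<in> {(x, y). x \<in> V \<and> y \<in> V \<and> hop_dist V E w h x y \<le> ennreal \<Delta>} ^^ s"
    and "x \<in> V" "0 \<le> \<Delta>"
  shows "y \<in> V \<and> hop_dist V E w (s * h) x y \<le> ennreal (s * \<Delta>)"
  using assms(1)
proof (induction s arbitrary: y)
  case 0
  then show ?case using assms(2) by (simp add: hop_dist_self)
next
  case (Suc s)
  obtain z where z: "z \<in> V" "hop_dist V E w (s * h) x z \<le> ennreal (s * \<Delta>)"
    "y \<in> V" "hop_dist V E w h z y \<le> ennreal \<Delta>"
    using Suc.prems by (auto dest!: Suc.IH)
  have "hop_dist V E w (s * h + h) x y \<le> hop_dist V E w (s * h) x z + hop_dist V E w h z y"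
    by (rule hop_dist_triangle)
  also have "\<dots> \<le> ennreal (s * \<Delta>) + ennreal \<Delta>" by (intro add_mono z)
  also have "\<dots> = ennreal (Suc s * \<Delta>)"
    using assms(3) by (subst ennreal_plus[symmetric]) (auto simp: algebra_simps)
  finally show ?case using z by (simp add: add.commute)
qed

text \<open>
  Each surviving point of the cut-off part \<open>Y \<inter> B\<^sub>s\<close> is charged the boundary mass it causes;
  the charges to a point over all scales telescope to \<open>sum \<nu> Y powr (1 / \<kappa>)\<close>.
\<close>
lemma exists_ramsey_below_double:
  fixes \<nu> :: "'a \<Rightarrow> real"
  assumes \<kappa>: "1 \<le> \<kappa>" and J: "exp (- real J / \<kappa>) * ln W < ln 2" and "0 < \<Delta>"
    and b: "b = 8 * J + 2"
    and IH: "\<And>X Y. X \<subseteq> V \<Longrightarrow> Y \<subseteq> X \<Longrightarrow> (\<And>y. y \<in> Y \<Longrightarrow> 1 \<le> \<nu> y) \<Longrightarrow> sum \<nu> Y \<le> W \<Longrightarrow>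
      \<exists>U M. ramsey_below b h \<Delta> X U M \<and> M \<subseteq> Y \<and> sum \<nu> Y powr (1 - 1 / \<kappa>) \<le> sum \<nu> M"
    and "X \<subseteq> V" "Y \<subseteq> X" "\<And>y. y \<in> Y \<Longrightarrow> 1 \<le> \<nu> y" "sum \<nu> Y \<le> W"
  shows "\<exists>U M. ramsey_below b h (2 * \<Delta>) X U M \<and> M \<subseteq> Y \<and> sum \<nu> Y powr (1 - 1 / \<kappa>) \<le> sum \<nu> M"
  using assms(6-9)
\<comment> \<open>One cluster \<open>A\<close> is cut off at a time. Inside \<open>A\<close> the
  finer scale takes over by \<open>IH\<close> and its ultrametric is capped; the remainder stays at
  scale \<open>2 * \<Delta>\<close> and has fewer candidate survivors, since the centre
  \<open>v\<close> is not in \<open>Yo\<close>.\<close>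
proof (induction "card Y" arbitrary: X Y rule: less_induct)
  case less
  have finX: "finite X" using less.prems(1) finite_vertices by (rule finite_subset)
  have finY: "finite Y" using less.prems(2) finX by (rule finite_subset)
  show ?case
  proof (cases "Y = {}")
    case True
    then show ?thesis using ramsey_below_discrete[OF less.prems(1), of "{}" h "2 * \<Delta>" b] by auto
  next
    case False
    define R where "R = {(x, y). x \<in> V \<and> y \<in> V \<and> hop_dist V E w h x y \<le> ennreal (2 * \<Delta>)}"
    have R: "sym R" unfolding R_def sym_def by (auto simp: hop_dist_commute)
    have refl: "(x, x) \<in> R" if "x \<in> V" for x unfolding R_def using that by (simp add: hop_dist_self)
    have YV: "Y \<subseteq> V" using less.prems by blast
    obtain v s where v: "v \<in> Y" "s \<le> 4 * J"
      and pos: "0 < sum \<nu> (Y \<inter> (R ^^ s) `` {v})"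
      and cut: "sum \<nu> (Y \<inter> (R ^^ (s + 2)) `` {v})
       \<le> sum \<nu> (Y \<inter> (R ^^ s) `` {v}) * (sum \<nu> Y / sum \<nu> (Y \<inter> (R ^^ s) `` {v})) powr (1 / \<kappa>)"
      using exists_sparse_cut[OF finY False R _ less.prems(3,4) \<kappa> J] refl YV by blast
    \<comment> \<open>The cluster boundary lies at radius \<open>s + 1\<close>. Candidates must be
      within \<open>s\<close> or beyond \<open>s + 2\<close>, one full step away from it on either
      side, so no neighbour of theirs is separated from them.\<close>
    define A where "A = X \<inter> (R ^^ (s + 1)) `` {v}"
    define Yi where "Yi = Y \<inter> (R ^^ s) `` {v}"
    define Yo where "Yo = Y - (R ^^ (s + 2)) `` {v}"
    have next_step: "y \<in> (R ^^ Suc j) `` {v}" if "x \<in> (R ^^ j) `` {v}" "(x, y) \<in> R" for x y j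
      using that by auto
    have YiA: "Yi \<subseteq> A" unfolding Yi_def A_def using less.prems(2) YV next_step[OF _ refl] by fastforce
    have YoA: "Yo \<subseteq> X - A"
      unfolding Yo_def A_def using less.prems(2) YV next_step[OF _ refl, of _ "s + 1"] by fastforce
    have subY: "sum \<nu> Z \<le> W" if "Z \<subseteq> Y" for Z
      using sum_mono2[OF finY that, of \<nu>] less.prems(3,4) by force
    have AV: "A \<subseteq> V" "X - A \<subseteq> V" using less.prems(1) unfolding A_def by auto
    obtain U1 M1 where 1: "ramsey_below b h \<Delta> A U1 M1" "M1 \<subseteq> Yi"
      "sum \<nu> Yi powr (1 - 1 / \<kappa>) \<le> sum \<nu> M1"
      using IH[OF AV(1) YiA] less.prems(3) subY[of Yi] unfolding Yi_def by blast
    have "v \<notin> Yo"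
    proof -
      have "(v, v) \<in> R ^^ j" for j using refl[of v] v(1) YV by (induction j) auto
      then show ?thesis unfolding Yo_def by blast
    qed
    then have "card Yo < card Y" using v(1) finY unfolding Yo_def by (intro psubset_card_mono) auto
    then obtain U2 M2 where 2: "ramsey_below b h (2 * \<Delta>) (X - A) U2 M2" "M2 \<subseteq> Yo"
      "sum \<nu> Yo powr (1 - 1 / \<kappa>) \<le> sum \<nu> M2"
      using less.hyps[OF _ AV(2) YoA] less.prems(3) subY[of Yo] unfolding Yo_def by blast
    have diam: "hop_dist V E w (b * h) x y \<le> ennreal (b * (2 * \<Delta>))" if "x \<in> A" "y \<in> A" for x y
    proof -
      have "(x, v) \<in> R ^^ (s + 1)" "(v, y) \<in> R ^^ (s + 1)"
        using that sym_relpow[OF R, of "s + 1"] unfolding A_def by (blast dest: symD)+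
      then have "(x, y) \<in> R ^^ ((s + 1) + (s + 1))" unfolding relpow_add by blast
      from hop_dist_relpow[OF this[unfolded R_def]] that AV assms(3)
      have "hop_dist V E w (((s + 1) + (s + 1)) * h) x y \<le> ennreal (real ((s + 1) + (s + 1)) * (2 * \<Delta>))"
        by auto
      \<comment> \<open>Two points of \<open>A\<close> are joined through \<open>v\<close>; with
        \<open>s \<le> 4 * J\<close> this explains \<open>b = 8 * J + 2\<close>.\<close>
      moreover have sb: "(s + 1) + (s + 1) \<le> b" using v(2) b by simp
      moreover have "ennreal (real ((s + 1) + (s + 1)) * (2 * \<Delta>)) \<le> ennreal (b * (2 * \<Delta>))"
        using assms(3) sb by (intro ennreal_leI mult_right_mono of_nat_mono) auto
      ultimately show ?thesis
        by (meson hop_dist_mono mult_le_mono1 order_trans)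
    qed
    have near: "\<not> hop_dist V E w h x y \<le> ennreal (2 * \<Delta>)" if "x \<in> Yi" "y \<in> X - A" for x y
    proof
      assume "hop_dist V E w h x y \<le> ennreal (2 * \<Delta>)"
      then have "(x, y) \<in> R" using that less.prems unfolding R_def Yi_def by auto
      with that show False using next_step[of x s y] unfolding Yi_def A_def by auto
    qed
    have far: "\<not> hop_dist V E w h x y \<le> ennreal (2 * \<Delta>)" if "x \<in> Yo" "y \<in> A" for x y
    proof
      assume "hop_dist V E w h x y \<le> ennreal (2 * \<Delta>)"
      then have "(y, x) \<in> R" using that less.prems unfolding R_def Yo_def A_def
        by (auto simp: hop_dist_commute)
      with that show False using next_step[of y "s + 1" x] unfolding Yo_def A_def by auto
    qed
    let ?U1 = "\<lambda>u v. min (U1 u v) (ennreal (b * (2 * \<Delta>)))"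
    have lift: "ramsey_below b h (2 * \<Delta>) A ?U1 M1"
      by (rule ramsey_below_double[OF 1(1) assms(3) _ diam]) (simp_all add: b)
    have XA: "A \<union> (X - A) = X" unfolding A_def by blast
    obtain U where "ramsey_below b h (2 * \<Delta>) X U (M1 \<union> M2)"
    proof
      show "ramsey_below b h (2 * \<Delta>) X (\<lambda>u v. if u \<in> A \<and> v \<in> A then ?U1 u v
        else if u \<in> X - A \<and> v \<in> X - A then U2 u v else \<top>) (M1 \<union> M2)"
        using ramsey_below_union[OF lift 2(1)] near far 1(2) 2(2) unfolding XA by blast
    qed
    moreover have "M1 \<union> M2 \<subseteq> Y" using 1(2) 2(2) unfolding Yi_def Yo_def by blast
    moreover have "sum \<nu> Y powr (1 - 1 / \<kappa>) \<le> sum \<nu> (M1 \<union> M2)"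
    proof -
      define S where "S = sum \<nu> Y"
      have SY: "sum \<nu> Z \<le> S" if "Z \<subseteq> Y" for Z
        unfolding S_def using sum_mono2[OF finY that, of \<nu>] less.prems(3) by force
      have powr_split: "x powr (1 - 1 / \<kappa>) = x / x powr (1 / \<kappa>)" if "0 < x" for x :: real
        using that by (simp add: powr_diff)
      have S: "0 < S" using pos SY[of "Y \<inter> (R ^^ s) `` {v}"] by simp
      \<comment> \<open>The cut inequality divided by \<open>S powr (1 / \<kappa>)\<close>: the
        factor \<open>S\<close> cancels, and what the inside keeps pays for the discarded layers
        too.\<close>
      have yi: "sum \<nu> (Y \<inter> (R ^^ (s + 2)) `` {v}) / S powr (1 / \<kappa>) \<le> sum \<nu> Yi powr (1 - 1 / \<kappa>)"
      proof -
        have p: "0 < sum \<nu> Yi" using pos unfolding Yi_def .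
        have "sum \<nu> (Y \<inter> (R ^^ (s + 2)) `` {v}) / S powr (1 / \<kappa>)
            \<le> sum \<nu> Yi * (S / sum \<nu> Yi) powr (1 / \<kappa>) / S powr (1 / \<kappa>)"
          using cut unfolding Yi_def S_def by (intro divide_right_mono) auto
        also have "\<dots> = sum \<nu> Yi powr (1 - 1 / \<kappa>)"
          using S p by (simp add: powr_divide powr_split)
        finally show ?thesis .
      qed
      \<comment> \<open>On the outside only \<open>sum \<nu> Yo \<le> S\<close> is needed.\<close>
      have yo: "sum \<nu> Yo / S powr (1 / \<kappa>) \<le> sum \<nu> Yo powr (1 - 1 / \<kappa>)"
      proof (cases "0 < sum \<nu> Yo")
        case True
        have "sum \<nu> Yo / S powr (1 / \<kappa>) \<le> sum \<nu> Yo / sum \<nu> Yo powr (1 / \<kappa>)"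
          using True SY[of Yo] \<kappa> unfolding Yo_def
          by (intro divide_left_mono powr_mono2 mult_pos_pos) auto
        then show ?thesis using True by (simp add: powr_split)
      next
        case False
        then have "sum \<nu> Yo / S powr (1 / \<kappa>) \<le> 0" by (simp add: divide_nonpos_nonneg)
        also have "0 \<le> sum \<nu> Yo powr (1 - 1 / \<kappa>)" by simp
        finally show ?thesis .
      qed
      have "S = sum \<nu> (Y \<inter> (R ^^ (s + 2)) `` {v}) + sum \<nu> Yo"
        unfolding S_def Yo_def by (rule sum.Int_Diff[OF finY])
      then have "S powr (1 - 1 / \<kappa>)
          = sum \<nu> (Y \<inter> (R ^^ (s + 2)) `` {v}) / S powr (1 / \<kappa>) + sum \<nu> Yo / S powr (1 / \<kappa>)"
        using powr_split[OF S] by (simp add: add_divide_distrib[symmetric])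
      also have "\<dots> \<le> sum \<nu> Yi powr (1 - 1 / \<kappa>) + sum \<nu> Yo powr (1 - 1 / \<kappa>)"
        using yi yo by (rule add_mono)
      also have "\<dots> \<le> sum \<nu> M1 + sum \<nu> M2" using 1(3) 2(3) by simp
      also have "\<dots> = sum \<nu> (M1 \<union> M2)"
      proof (rule sum.union_disjoint[symmetric])
        show "finite M1" "finite M2"
          using 1(2) 2(2) finY unfolding Yi_def Yo_def by (auto intro: finite_subset)
        show "M1 \<inter> M2 = {}" using 1(2) 2(2) YiA YoA by blast
      qed
      finally show ?thesis unfolding S_def .
    qed
    ultimately show ?thesis by (intro exI conjI)
  qed
qed

text \<open>Doubling starts below the least edge weight and ends above every finite
  \<open>h\<close>-hop distance. The guarantees do not degrade with the number of scales, hence the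
  aspect ratio does not matter.\<close>

lemma exists_ramsey_ultrametric:
  fixes \<nu> :: "'a \<Rightarrow> real"
  assumes \<kappa>: "1 \<le> \<kappa>" and J: "exp (- real J / \<kappa>) * ln W < ln 2"
    and "Y \<subseteq> V" "\<And>y. y \<in> Y \<Longrightarrow> 1 \<le> \<nu> y" "sum \<nu> Y \<le> W"
    and t: "2 * (8 * real J + 2) \<le> t" and \<beta>: "8 * real J + 2 \<le> \<beta>"
  shows "\<exists>U M. M \<subseteq> Y \<and> sum \<nu> Y powr (1 - 1 / \<kappa>) \<le> sum \<nu> M \<and>
     ultrametric_on V U \<and> dominating V E w U \<and> ramsey_hop_distortion V E w U t M \<beta> h"
proof -
  define b where "b = 8 * J + 2"
  \<comment> \<open>The inserted \<open>1\<close> keeps the minimum defined for an edgeless graph;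
    halving makes every edge weight strictly larger than \<open>a\<close>.\<close>
  define a where "a = Min (insert 1 (w ` E)) / 2"
  have a: "0 < a" unfolding a_def using finite_edges weight_pos by (subst divide_pos_pos) auto
  have aw: "a < w e" if "e \<in> E" for e
  proof -
    have "Min (insert 1 (w ` E)) \<le> w e" using finite_edges that by (intro Min_le) auto
    then show ?thesis using a unfolding a_def by linarith
  qed
  have all: "\<exists>U M. ramsey_below b h (2 ^ i * a) X U M \<and> M \<subseteq> Y \<and> sum \<nu> Y powr (1 - 1 / \<kappa>) \<le> sum \<nu> M"
    if "X \<subseteq> V" "Y \<subseteq> X" "\<And>y. y \<in> Y \<Longrightarrow> 1 \<le> \<nu> y" "sum \<nu> Y \<le> W" for i X Y
    using that
  proof (induction i arbitrary: X Y)
    case 0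
    have fin: "finite Y" using 0 finite_vertices by (meson finite_subset)
    \<comment> \<open>At the finest scale all of \<open>Y\<close> survives. A nonempty
      \<open>Y\<close> has mass at least 1, which an exponent of at most 1 does not
      increase.\<close>
    have "sum \<nu> Y powr (1 - 1 / \<kappa>) \<le> sum \<nu> Y"
    proof (cases "Y = {}")
      case False
      have "1 \<le> sum \<nu> Y"
      proof -
        obtain y where y: "y \<in> Y" using False by blast
        have "1 \<le> \<nu> y" using 0(3) y by blast
        also have "\<nu> y \<le> sum \<nu> Y" by (rule member_le_sum) (use y fin in \<open>auto dest!: 0(3)\<close>)
        finally show ?thesis .
      qed
      then have "sum \<nu> Y powr (1 - 1 / \<kappa>) \<le> sum \<nu> Y powr 1"
        using \<kappa> by (intro powr_mono) auto
      with \<open>1 \<le> sum \<nu> Y\<close> show ?thesis by simp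
    qed simp
    moreover have "ramsey_below b h (2 ^ 0 * a) X (\<lambda>u v. if u = v then 0 else \<top>) Y"
      by (rule ramsey_below_discrete[OF 0(1,2)]) (use aw a hop_dist_small_imp_eq[OF aw] in auto)
    ultimately show ?case by blast
  next
    case (Suc i)
    have "0 < 2 ^ i * a" using a by simp
    from exists_ramsey_below_double[OF \<kappa> J this b_def Suc.IH Suc.prems]
    show ?case by (simp add: mult.assoc)
  qed
  define s where "s = real (card V) * (\<Sum>e\<in>E. w e)"
  obtain i where i: "s / a < 2 ^ i" using real_arch_pow[of 2 "s / a"] by auto
  have si: "s \<le> 2 ^ i * a" using i a by (simp add: field_simps)
  obtain U M where UM: "ramsey_below b h (2 ^ i * a) V U M" "M \<subseteq> Y"
      "sum \<nu> Y powr (1 - 1 / \<kappa>) \<le> sum \<nu> M"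
    using all[OF order_refl assms(3-5)] by blast
  have low: "hop_dist V E w (b * h) u v \<le> U u v" if "u \<in> V" "v \<in> V" for u v
    using UM(1) that unfolding ramsey_below_def by blast
  have dom: "dominating V E w U"
    unfolding dominating_def using low graph_dist_le_hop_dist by (meson order_trans)
  have hop: "hop_dist V E w (nat \<lfloor>\<beta> * real h\<rfloor>) u v \<le> U u v" if "u \<in> V" "v \<in> V" for u v
  proof -
    have "real (b * h) \<le> \<beta> * real h"
      using \<beta> unfolding b_def of_nat_mult by (intro mult_right_mono) auto
    then have "b * h \<le> nat \<lfloor>\<beta> * real h\<rfloor>" by (rule le_nat_floor)
    then show ?thesis using low[OF that] hop_dist_mono by (meson order_trans)
  qed
  have dist: "U u v \<le> ennreal t * hop_dist V E w h u v" if u: "u \<in> M" "v \<in> V" for u v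
  proof (cases "hop_dist V E w h u v < \<top>")
    case True
    then have "hop_dist V E w h u v \<le> ennreal s" unfolding s_def by (rule hop_dist_bounded)
    also have "\<dots> \<le> ennreal (2 ^ i * a)" using si by (rule ennreal_leI)
    finally have "U u v \<le> ennreal (2 * b) * hop_dist V E w h u v"
      using UM(1) u unfolding ramsey_below_def by blast
    also have "\<dots> \<le> ennreal t * hop_dist V E w h u v"
      using t unfolding b_def by (intro mult_right_mono ennreal_leI) auto
    finally show ?thesis .
  next
    case False
    then have "hop_dist V E w h u v = \<top>" by (simp add: less_top[symmetric])
    \<comment> \<open>Positivity matters here, because \<open>0 * \<top> = 0\<close> in
      \<open>ennreal\<close>.\<close>
    moreover have "0 < t" using t of_nat_0_le_iff[of J, where ?'a = real] by argo
    ultimately show ?thesis by (simp add: ennreal_mult_top)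
  qed
  have "M \<subseteq> V" using UM(2) assms(3) by (rule subset_trans)
  with hop dist have "ramsey_hop_distortion V E w U t M \<beta> h"
    unfolding ramsey_hop_distortion_def by (intro conjI ballI)
  moreover have "ultrametric_on V U" using UM(1) unfolding ramsey_below_def by (rule conjunct1)
  ultimately show ?thesis using dom UM(2,3) by (intro exI conjI)
qed

end

section \<open>Choice of the number of radii\<close>

lemma lg_ge_1: "1 \<le> lg x"
  by (simp add: lg_def)

text \<open>The bound on \<open>W\<close> is the one met by \<open>n / \<theta>\<close> for
  \<open>\<theta> \<ge> 1 / (4 * n)\<close>, the ratio left after discarding light vertices. The
  factor \<open>ln 2\<close> is kept to cancel against the \<open>ln 2\<close> of the halving
  condition.\<close>

lemma ln_le_lg:
  assumes "0 < W" "W \<le> 4 * n\<^sup>2" "1 \<le> n"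
  shows "ln W \<le> ln 2 * (4 * lg n)"
proof -
  have "ln W \<le> ln (4 * n\<^sup>2)" using assms by (subst ln_le_cancel_iff) auto
  also have "\<dots> = ln ((2 * n)\<^sup>2)" by (simp add: power_mult_distrib)
  also have "\<dots> = 2 * ln (2 * n)" using assms(3) by (subst ln_realpow) auto
  also have "\<dots> = 2 * ln 2 + 2 * ln n" using assms(3) by (subst ln_mult) auto
  also have "ln n = ln 2 * log 2 n" by (simp add: log_def)
  also have "2 * ln 2 + 2 * (ln 2 * log 2 n) = ln 2 * (2 + 2 * log 2 n)" by (simp add: algebra_simps)
  also have "\<dots> \<le> ln 2 * (4 * lg n)" by (intro mult_left_mono) (auto simp: lg_def)
  finally show ?thesis .
qed

text \<open>With \<open>L = lg (lg n)\<close>, \<open>lg n \<le> exp L\<close> and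
  \<open>4 < exp (2 * L)\<close>, so \<open>J \<ge> 3 * \<kappa> * L\<close> beats the factor
  \<open>4 * lg n\<close>. Rounding up gives \<open>8 * J + 2 \<le> 24 * \<kappa> * L + 10\<close>,
  and \<open>1 \<le> \<kappa> * L\<close> turns this into the constant 34.\<close>

lemma exists_radius:
  assumes "1 \<le> \<kappa>" "0 < W" "W \<le> 4 * n\<^sup>2" "1 \<le> n"
  shows "\<exists>J::nat. exp (- real J / \<kappa>) * ln W < ln 2 \<and> 8 * real J + 2 \<le> 34 * (\<kappa> * lg (lg n))"
proof -
  define L where "L = lg (lg n)"
  define J where "J = nat \<lceil>3 * (\<kappa> * L)\<rceil>"
  have L: "1 \<le> L" unfolding L_def by (rule lg_ge_1)
  have \<kappa>L: "1 \<le> \<kappa> * L" using L assms(1) mult_mono[of 1 \<kappa> 1 L] by simp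
  have J: "3 * (\<kappa> * L) \<le> J" "real J \<le> 3 * (\<kappa> * L) + 1"
    unfolding J_def using \<kappa>L by linarith+
  have "lg n \<le> exp L"
  proof -
    have "ln (lg n) \<le> log 2 (lg n)"
      using lg_ge_1[of n] ln_2_less_1 by (simp add: log_def field_simps mult_left_le)
    also have "\<dots> \<le> L" by (simp add: L_def lg_def)
    finally show ?thesis using lg_ge_1[of n] by (metis exp_ln exp_le_cancel_iff less_le_trans zero_less_one)
  qed
  moreover have "4 < exp (2 * L)"
  proof -
    have "2 < exp (1::real)" using exp_ge_add_one_self[of "1::real"] ln_2_less_1
      by (metis exp_less_cancel_iff exp_ln zero_less_numeral)
    then have "2 < exp L" using L by (meson exp_le_cancel_iff less_le_trans)
    then have "2 * 2 < exp L * exp L" by (intro mult_strict_mono) auto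
    then show ?thesis by (simp flip: exp_add)
  qed
  ultimately have "4 * lg n < exp (2 * L) * exp L"
    using lg_ge_1[of n] by (intro mult_less_le_imp_less) auto
  also have "\<dots> = exp (3 * L)" by (simp flip: exp_add)
  also have "\<dots> \<le> exp (real J / \<kappa>)" using J(1) assms(1) by (simp add: field_simps)
  finally have *: "4 * lg n < exp (real J / \<kappa>)" .
  have "exp (- real J / \<kappa>) * ln W \<le> exp (- real J / \<kappa>) * (ln 2 * (4 * lg n))"
    using ln_le_lg[OF assms(2-4)] by (intro mult_left_mono) auto
  also have "\<dots> < exp (- real J / \<kappa>) * (ln 2 * exp (real J / \<kappa>))"
    using * by (intro mult_strict_left_mono) auto
  also have "\<dots> = ln 2" by (simp flip: exp_add add: mult.left_commute[of _ "ln 2"])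
  finally have "exp (- real J / \<kappa>) * ln W < ln 2" .
  moreover have "8 * real J + 2 \<le> 34 * (\<kappa> * L)" using J(2) \<kappa>L by linarith
  ultimately show ?thesis unfolding L_def by blast
qed

section \<open>Arbitrary vertex weights and the two distributions\<close>

context weighted_graph
begin

definition ramsey_pairs :: "real \<Rightarrow> real \<Rightarrow> nat \<Rightarrow> (('a \<Rightarrow> 'a \<Rightarrow> ennreal) \<times> 'a set) set" where
  "ramsey_pairs t \<beta> h = {(U, M). ultrametric_on V U \<and> dominating V E w U \<and> M \<subseteq> V \<and>
     ramsey_hop_distortion V E w U t M \<beta> h}"

lemma exists_ramsey_pair:
  fixes \<nu> :: "'a \<Rightarrow> real"
  assumes \<kappa>: "1 \<le> \<kappa>" and Y: "Y \<subseteq> V" "\<And>y. y \<in> Y \<Longrightarrow> 1 \<le> \<nu> y"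
    and n: "1 \<le> card V" and W: "0 < W" "sum \<nu> Y \<le> W" "W \<le> 4 * (real (card V))\<^sup>2"
    and t: "68 * (\<kappa> * lg (lg (card V))) \<le> t" and \<beta>: "34 * (\<kappa> * lg (lg (card V))) \<le> \<beta>"
  shows "\<exists>(U, M) \<in> ramsey_pairs t \<beta> h. M \<subseteq> Y \<and> sum \<nu> Y powr (1 - 1 / \<kappa>) \<le> sum \<nu> M"
proof -
  obtain J :: nat where J: "exp (- real J / \<kappa>) * ln W < ln 2"
      "8 * real J + 2 \<le> 34 * (\<kappa> * lg (lg (card V)))"
    using exists_radius[OF \<kappa> W(1,3)] n by auto
  have "2 * (8 * real J + 2) \<le> 2 * (34 * (\<kappa> * lg (lg (card V))))"
    using J(2) by (intro mult_left_mono) auto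
  also have "\<dots> = 68 * (\<kappa> * lg (lg (card V)))" by (simp add: mult.assoc[symmetric])
  finally have "2 * (8 * real J + 2) \<le> t" using t by (rule order_trans)
  moreover have "8 * real J + 2 \<le> \<beta>" using J(2) \<beta> by (rule order_trans)
  moreover note J(1)
  ultimately have "\<exists>U M. M \<subseteq> Y \<and> sum \<nu> Y powr (1 - 1 / \<kappa>) \<le> sum \<nu> M \<and>
     ultrametric_on V U \<and> dominating V E w U \<and> ramsey_hop_distortion V E w U t M \<beta> h"
    using exists_ramsey_ultrametric[where \<nu> = \<nu>, OF \<kappa> _ Y W(2)] by blast
  then obtain U M where "M \<subseteq> Y" "sum \<nu> Y powr (1 - 1 / \<kappa>) \<le> sum \<nu> M"
     "ultrametric_on V U" "dominating V E w U" "ramsey_hop_distortion V E w U t M \<beta> h" by blast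
  then have "(U, M) \<in> ramsey_pairs t \<beta> h" using Y(1) unfolding ramsey_pairs_def by simp
  with \<open>M \<subseteq> Y\<close> \<open>sum \<nu> Y powr (1 - 1 / \<kappa>) \<le> sum \<nu> M\<close> show ?thesis by blast
qed

text \<open>
  Vertices of weight below \<open>\<theta>\<close> times the average are discarded, which bounds the ratio between the
  total and the least weight by \<open>card V / \<theta>\<close>.
\<close>
lemma exists_heavy_ramsey_pair:
  fixes \<mu> :: "'a \<Rightarrow> real"
  assumes \<kappa>: "1 \<le> \<kappa>" and \<mu>: "\<And>v. 0 \<le> \<mu> v" and n: "1 \<le> card V"
    and \<theta>: "0 < \<theta>" "\<theta> < 1" "1 / (4 * real (card V)) \<le> \<theta>"
    and t: "68 * (\<kappa> * lg (lg (card V))) \<le> t" and \<beta>: "34 * (\<kappa> * lg (lg (card V))) \<le> \<beta>"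
  shows "\<exists>(U, M) \<in> ramsey_pairs t \<beta> h.
    (1 - \<theta>) * (card V / \<theta>) powr (- 1 / \<kappa>) * sum \<mu> V \<le> sum \<mu> M"
proof -
  define n where "n = real (card V)"
  define S where "S = sum \<mu> V"
  have n1: "1 \<le> n" using n unfolding n_def by simp
  define W where "W = n / \<theta>"
  have W: "0 < W" "W \<le> 4 * n\<^sup>2"
    using \<theta> n1 unfolding W_def n_def by (auto simp: field_simps power2_eq_square)
  show ?thesis
  proof (cases "S = 0")
    case True
    \<comment> \<open>Without any weight to collect, every pair will do; \<open>Y = {}\<close>
      supplies one.\<close>
    then have "0 \<le> sum \<mu> M" for M using \<mu> by (simp add: sum_nonneg)
    with True exists_ramsey_pair[OF \<kappa> _ _ n W(1) _ W(2)[unfolded n_def] t \<beta>, of "{}" \<mu>] W show ?thesis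
      unfolding S_def by fastforce
  next
    case False
    then have S: "0 < S" unfolding S_def using \<mu> by (simp add: sum_nonneg less_le)
    define Y where "Y = {v \<in> V. \<theta> * S / n \<le> \<mu> v}"
    \<comment> \<open>Scaled so that the threshold \<open>\<theta> * S / n\<close> becomes 1 and the
      total over \<open>V\<close> becomes \<open>W\<close>.\<close>
    define \<nu> where "\<nu> v = W / S * \<mu> v" for v
    have YV: "Y \<subseteq> V" unfolding Y_def by blast
    have sum\<nu>: "sum \<nu> Z = W / S * sum \<mu> Z" for Z unfolding \<nu>_def by (simp add: sum_distrib_left)
    have \<nu>1: "1 \<le> \<nu> y" if "y \<in> Y" for y
      using that S \<theta> n1 unfolding Y_def \<nu>_def W_def by (simp add: field_simps)
    have light: "sum \<mu> (V - Y) \<le> \<theta> * S"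
    proof -
      have "sum \<mu> (V - Y) \<le> (\<Sum>v\<in>V - Y. \<theta> * S / n)"
        by (rule sum_mono) (auto simp: Y_def)
      also have "\<dots> \<le> (\<Sum>v\<in>V. \<theta> * S / n)"
        using finite_vertices S \<theta> n1 by (intro sum_mono2) auto
      also have "\<dots> = \<theta> * S" using n1 by (simp add: n_def)
      finally show ?thesis .
    qed
    have split: "S = sum \<mu> Y + sum \<mu> (V - Y)"
      unfolding S_def by (metis YV finite_vertices sum.subset_diff add.commute)
    have "sum \<mu> Y \<le> S" unfolding split using \<mu> by (simp add: sum_nonneg)
    then have "sum \<nu> Y \<le> W" unfolding sum\<nu> using W S by (simp add: field_simps)
    then obtain U M where UM: "(U, M) \<in> ramsey_pairs t \<beta> h" "sum \<nu> Y powr (1 - 1 / \<kappa>) \<le> sum \<nu> M"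
      using exists_ramsey_pair[where \<nu> = \<nu>, OF \<kappa> YV \<nu>1 n W(1) _ W(2)[unfolded n_def] t \<beta>] by blast
    have \<mu>Y: "(1 - \<theta>) * S \<le> sum \<mu> Y" using light split by (simp add: algebra_simps)
    then have "0 < sum \<mu> Y" using \<theta> S by (smt (verit) mult_pos_pos)
    then have \<nu>Y: "0 < sum \<nu> Y" unfolding sum\<nu> using W S by simp
    have "W / S * ((1 - \<theta>) * W powr (- 1 / \<kappa>) * S) = W / S * ((1 - \<theta>) * S) * W powr (- 1 / \<kappa>)"
      by (simp add: algebra_simps)
    also have "\<dots> \<le> sum \<nu> Y * W powr (- 1 / \<kappa>)"
      unfolding sum\<nu> using \<mu>Y W S by (intro mult_right_mono mult_left_mono) auto
    \<comment> \<open>The exponent is negative and \<open>sum \<nu> Y \<le> W\<close>.\<close>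
    also have "\<dots> \<le> sum \<nu> Y * sum \<nu> Y powr (- 1 / \<kappa>)"
      using \<open>sum \<nu> Y \<le> W\<close> \<nu>Y \<kappa> by (intro mult_left_mono powr_mono2') auto
    also have "\<dots> = sum \<nu> Y powr (1 - 1 / \<kappa>)"
      using \<nu>Y powr_add[of "sum \<nu> Y" 1 "- 1 / \<kappa>"] by simp
    also have "\<dots> \<le> W / S * sum \<mu> M" using UM(2) unfolding sum\<nu> .
    finally have "(1 - \<theta>) * W powr (- 1 / \<kappa>) * S \<le> sum \<mu> M"
      using W S by (subst (asm) mult_le_cancel_left_pos) auto
    then show ?thesis using UM(1) unfolding W_def S_def n_def by blast
  qed
qed

lemma ramsey_pmf:
  assumes "0 \<le> p" "p \<le> 1" "0 < \<delta>"
    and "\<And>\<mu> :: 'a \<Rightarrow> real. (\<And>v. 0 \<le> \<mu> v) \<Longrightarrow> \<exists>(U, M) \<in> ramsey_pairs t \<beta> h. p * sum \<mu> V \<le> sum \<mu> M"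
  shows "\<exists>D. set_pmf D \<subseteq> ramsey_pairs t \<beta> h \<and>
    (\<forall>v\<in>V. p - \<delta> \<le> measure_pmf.prob D {(U, M). v \<in> M})"
proof -
  have eq: "{(U, M). v \<in> M} = {x. v \<in> snd x}" for v :: 'a by auto
  have "\<exists>x\<in>ramsey_pairs t \<beta> h. p * sum \<mu> V \<le> sum \<mu> (V \<inter> snd x)"
    if \<mu>: "\<And>v. 0 \<le> \<mu> v" for \<mu> :: "'a \<Rightarrow> real"
  proof -
    obtain U M where UM: "(U, M) \<in> ramsey_pairs t \<beta> h" "p * sum \<mu> V \<le> sum \<mu> M"
      using assms(4)[of \<mu>, OF \<mu>] by blast
    then have "V \<inter> M = M" unfolding ramsey_pairs_def by auto
    with UM show ?thesis by (intro bexI[of _ "(U, M)"]) simp_all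
  qed
  then show ?thesis unfolding eq
    using exists_covering_pmf[OF finite_vertices assms(1-3), of "ramsey_pairs t \<beta> h" snd] by blast
qed

lemma powr_neg_inverse_ge:
  fixes x \<kappa> :: real
  assumes "0 < x"
  shows "1 - ln x / \<kappa> \<le> x powr (- 1 / \<kappa>)"
  using exp_ge_add_one_self[of "- 1 / \<kappa> * ln x"] assms by (simp add: powr_def)

text \<open>Here \<open>\<kappa> = k\<close> and \<open>\<theta> = 1 / 2\<close>. Discarding light
  vertices costs a factor 1/2, and \<open>2 powr (- 1 / k)\<close> costs at most another 1/2, whence
  \<open>p\<close>. The minimax slack \<open>p / 2\<close> leaves 1/8.\<close>

lemma ramsey_pmf_power:
  assumes n: "1 \<le> card V" and k: "1 \<le> k"
  shows "\<exists>D. set_pmf D \<subseteq> ramsey_pairs (68 * (real k * lg (lg (card V)))) (34 * (real k * lg (lg (card V)))) h \<and>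
    (\<forall>v\<in>V. 1 / 8 * real (card V) powr (- 1 / real k) \<le> measure_pmf.prob D {(U, M). v \<in> M})"
proof -
  define n where "n = real (card V)"
  define p where "p = n powr (- 1 / real k) / 4"
  have n1: "1 \<le> n" using n unfolding n_def by simp
  have p0: "0 < p" unfolding p_def using n1 by simp
  have "n powr (- 1 / real k) \<le> n powr 0" using n1 k by (intro powr_mono) auto
  then have p1: "p \<le> 1" unfolding p_def using n1 by simp
  have half: "1 / 2 \<le> (2::real) powr (- 1 / real k)"
  proof -
    have "(2::real) powr (- 1) \<le> 2 powr (- 1 / real k)" using k by (intro powr_mono) (auto simp: field_simps)
    then show ?thesis by (simp add: powr_minus_divide)
  qed
  have pp: "p \<le> (1 - 1 / 2) * (card V / (1 / 2)) powr (- 1 / real k)"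
  proof -
    have "p \<le> n powr (- 1 / real k) * ((2::real) powr (- 1 / real k)) / 2"
      unfolding p_def using mult_left_mono[OF half, of "n powr (- 1 / real k)"] by simp
    also have "\<dots> = (1 - 1 / 2) * (n * 2) powr (- 1 / real k)" using n1 by (subst powr_mult) auto
    finally show ?thesis by (simp add: n_def)
  qed
  have "\<exists>(U, M) \<in> ramsey_pairs (68 * (real k * lg (lg (card V)))) (34 * (real k * lg (lg (card V)))) h.
      p * sum \<mu> V \<le> sum \<mu> M" if \<mu>: "\<And>v. 0 \<le> \<mu> v" for \<mu> :: "'a \<Rightarrow> real"
  proof -
    have "1 / (4 * real (card V)) \<le> 1 / 2" using n by (simp add: field_simps)
    then obtain U M where UM: "(U, M) \<in> ramsey_pairs (68 * (real k * lg (lg (card V)))) (34 * (real k * lg (lg (card V)))) h"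
      "(1 - 1 / 2) * (card V / (1 / 2)) powr (- 1 / real k) * sum \<mu> V \<le> sum \<mu> M"
      using exists_heavy_ramsey_pair[of "real k" \<mu> "1 / 2"] k \<mu> n by fastforce
    have "p * sum \<mu> V \<le> (1 - 1 / 2) * (card V / (1 / 2)) powr (- 1 / real k) * sum \<mu> V"
      using pp \<mu> by (intro mult_right_mono sum_nonneg) auto
    with UM show ?thesis by force
  qed
  from ramsey_pmf[OF _ p1 _ this, of "p / 2"] p0 show ?thesis
    unfolding p_def n_def by auto
qed

text \<open>The choice \<open>\<kappa> = 16 * lg n / \<epsilon>\<close> gives
  \<open>ln W \<le> \<kappa> * \<epsilon> / 4\<close>, so each power loses at most
  \<open>\<epsilon> / 4\<close>. Discarding with \<open>\<theta> = \<epsilon> / 4\<close> loses as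
  much again, and the minimax slack is \<open>\<epsilon> / 2\<close>. The constants are 68 * 16 and
  34 * 16.\<close>

lemma ramsey_pmf_epsilon:
  assumes n: "1 \<le> card V" and \<epsilon>: "0 < \<epsilon>" "\<epsilon> < 1"
    and t: "t = 1088 * (lg (card V) * lg (lg (card V)) / \<epsilon>)"
    and \<beta>: "\<beta> = 544 * (lg (card V) * lg (lg (card V)) / \<epsilon>)"
  shows "\<exists>D. set_pmf D \<subseteq> ramsey_pairs t \<beta> h \<and>
    (\<forall>v\<in>V. 1 - \<epsilon> \<le> measure_pmf.prob D {(U, M). v \<in> M})"
proof -
  define n where "n = real (card V)"
  have n1: "1 \<le> n" using n unfolding n_def by simp
  define \<kappa> where "\<kappa> = 16 * lg n / \<epsilon>"
  have \<kappa>: "1 \<le> \<kappa>" unfolding \<kappa>_def using lg_ge_1[of n] \<epsilon> by (simp add: field_simps)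
  have t': "68 * (\<kappa> * lg (lg (card V))) \<le> t" and \<beta>': "34 * (\<kappa> * lg (lg (card V))) \<le> \<beta>"
    unfolding t \<beta> \<kappa>_def n_def by simp_all
  have bound: "1 - \<epsilon> / 4 \<le> W powr (- 1 / \<kappa>)" if "0 < W" "W \<le> 4 * n\<^sup>2" for W
  proof -
    have "ln W \<le> ln 2 * (4 * lg n)" by (rule ln_le_lg[OF that n1])
    also have "\<dots> \<le> 1 * (4 * lg n)"
      using ln_2_less_1 lg_ge_1[of n] by (intro mult_right_mono) auto
    also have "\<dots> = \<epsilon> / 4 * \<kappa>" unfolding \<kappa>_def using \<epsilon> by simp
    finally have "ln W / \<kappa> \<le> \<epsilon> / 4" using \<kappa> by (simp add: field_simps)
    with powr_neg_inverse_ge[OF that(1), of \<kappa>] show ?thesis by linarith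
  qed
  show ?thesis
  \<comment> \<open>For such small \<open>\<epsilon>\<close> the threshold
    \<open>\<epsilon> / 4\<close> would be too low for \<open>W \<le> 4 * n\<^sup>2\<close>. Unit
    weights suffice instead: less than one vertex is lost, so \<open>M = V\<close> by integrality
    and one deterministic pair works.\<close>
  proof (cases "\<epsilon> < 1 / n")
    case True
    have n4: "n \<le> 4 * n\<^sup>2" using n1 by (simp add: power2_eq_square mult_le_cancel_left1)
    obtain U M where UM: "(U, M) \<in> ramsey_pairs t \<beta> h"
        "M \<subseteq> V" "n powr (1 - 1 / \<kappa>) \<le> card M"
      using exists_ramsey_pair[OF \<kappa> order_refl _ n _ _ n4[unfolded n_def] t' \<beta>', of "\<lambda>_. 1"] n1
      unfolding n_def by fastforce
    have "n * (1 - \<epsilon> / 4) \<le> n * n powr (- 1 / \<kappa>)"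
      using n1 n4 by (intro mult_left_mono bound) auto
    also have "\<dots> = n powr (1 - 1 / \<kappa>)" using n1 powr_add[of n 1 "- 1 / \<kappa>"] by simp
    finally have "n * (1 - \<epsilon> / 4) \<le> card M" using UM(3) by linarith
    moreover have "n * \<epsilon> < 1" using True n1 by (simp add: field_simps)
    ultimately have "n - 1 < card M" by (simp add: algebra_simps)
    then have "card V \<le> card M" unfolding n_def by linarith
    then have "M = V" using UM(2) finite_vertices card_seteq by blast
    then show ?thesis using UM(1) \<epsilon> by (intro exI[of _ "return_pmf (U, M)"]) (auto simp: measure_return_pmf)
  next
    case False
    then have \<theta>: "1 / (4 * real (card V)) \<le> \<epsilon> / 4" unfolding n_def by simp
    have "real (card V) / (\<epsilon> / 4) \<le> 4 * n\<^sup>2"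
      using False n1 \<epsilon> unfolding n_def by (simp add: field_simps power2_eq_square)
    then have "1 - \<epsilon> / 4 \<le> (real (card V) / (\<epsilon> / 4)) powr (- 1 / \<kappa>)"
      using n \<epsilon> by (intro bound) auto
    then have "(1 - \<epsilon> / 4) * (1 - \<epsilon> / 4) \<le> (1 - \<epsilon> / 4) * (real (card V) / (\<epsilon> / 4)) powr (- 1 / \<kappa>)"
      using \<epsilon> by (intro mult_left_mono) auto
    moreover have "1 - \<epsilon> / 2 \<le> (1 - \<epsilon> / 4) * (1 - \<epsilon> / 4)" by (simp add: algebra_simps)
    ultimately have p: "1 - \<epsilon> / 2 \<le> (1 - \<epsilon> / 4) * (real (card V) / (\<epsilon> / 4)) powr (- 1 / \<kappa>)" by linarith
    have "\<exists>(U, M) \<in> ramsey_pairs t \<beta> h. (1 - \<epsilon> / 2) * sum \<mu> V \<le> sum \<mu> M"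
      if \<mu>: "\<And>v. 0 \<le> \<mu> v" for \<mu> :: "'a \<Rightarrow> real"
    proof -
      obtain U M where UM: "(U, M) \<in> ramsey_pairs t \<beta> h"
        "(1 - \<epsilon> / 4) * (card V / (\<epsilon> / 4)) powr (- 1 / \<kappa>) * sum \<mu> V \<le> sum \<mu> M"
        using exists_heavy_ramsey_pair[where \<mu> = \<mu>, OF \<kappa> \<mu> n _ _ \<theta> t' \<beta>'] \<epsilon> by fastforce
      have "(1 - \<epsilon> / 2) * sum \<mu> V \<le> (1 - \<epsilon> / 4) * (card V / (\<epsilon> / 4)) powr (- 1 / \<kappa>) * sum \<mu> V"
        using p \<mu> by (intro mult_right_mono sum_nonneg) auto
      with UM show ?thesis by force
    qed
    from ramsey_pmf[OF _ _ _ this, of "\<epsilon> / 2"] \<epsilon> show ?thesis by auto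
  qed
qed

end

theorem theorem2:
  shows
  "(\<exists>C\<^sub>1 C\<^sub>2 c :: real. 0 < C\<^sub>1 \<and> 0 < C\<^sub>2 \<and> 0 < c \<and>
     (\<forall>(V :: 'a set) E w n k h.
        weighted_graph V E w \<and> n = card V \<and> k \<in> {1..n} \<and> h \<in> {1..n} \<longrightarrow>
        (\<exists>D :: (('a \<Rightarrow> 'a \<Rightarrow> ennreal) \<times> 'a set) pmf.
           (\<forall>(U, M) \<in> set_pmf D.
              ultrametric_on V U \<and> dominating V E w U \<and> M \<subseteq> V \<and>
              ramsey_hop_distortion V E w U
                (C\<^sub>1 * (real k * lg (lg (real n)))) M (C\<^sub>2 * (real k * lg (lg (real n)))) h) \<and>
           (\<forall>v\<in>V. measure_pmf.prob D {(U, M). v \<in> M} \<ge> c * real n powr (- 1 / real k)))))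
   \<and>
   (\<exists>C\<^sub>1 C\<^sub>2 :: real. 0 < C\<^sub>1 \<and> 0 < C\<^sub>2 \<and>
     (\<forall>(V :: 'a set) E w n h (\<epsilon> :: real).
        weighted_graph V E w \<and> n = card V \<and> h \<in> {1..n} \<and> 0 < \<epsilon> \<and> \<epsilon> < 1 \<longrightarrow>
        (\<exists>D :: (('a \<Rightarrow> 'a \<Rightarrow> ennreal) \<times> 'a set) pmf.
           (\<forall>(U, M) \<in> set_pmf D.
              ultrametric_on V U \<and> dominating V E w U \<and> M \<subseteq> V \<and>
              ramsey_hop_distortion V E w U
                (C\<^sub>1 * (lg (real n) * lg (lg (real n)) / \<epsilon>)) M
                (C\<^sub>2 * (lg (real n) * lg (lg (real n)) / \<epsilon>)) h) \<and>
           (\<forall>v\<in>V. measure_pmf.prob D {(U, M). v \<in> M} \<ge> 1 - \<epsilon>))))"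
proof (intro conjI)
  show "\<exists>C\<^sub>1 C\<^sub>2 c :: real. 0 < C\<^sub>1 \<and> 0 < C\<^sub>2 \<and> 0 < c \<and>
     (\<forall>(V :: 'a set) E w n k h.
        weighted_graph V E w \<and> n = card V \<and> k \<in> {1..n} \<and> h \<in> {1..n} \<longrightarrow>
        (\<exists>D :: (('a \<Rightarrow> 'a \<Rightarrow> ennreal) \<times> 'a set) pmf.
           (\<forall>(U, M) \<in> set_pmf D.
              ultrametric_on V U \<and> dominating V E w U \<and> M \<subseteq> V \<and>
              ramsey_hop_distortion V E w U
                (C\<^sub>1 * (real k * lg (lg (real n)))) M (C\<^sub>2 * (real k * lg (lg (real n)))) h) \<and>
           (\<forall>v\<in>V. measure_pmf.prob D {(U, M). v \<in> M} \<ge> c * real n powr (- 1 / real k))))"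
  proof (rule exI[of _ 68], rule exI[of _ 34], rule exI[of _ "1 / 8"], intro conjI allI impI)
    fix V :: "'a set" and E w and n k h :: nat
    assume asm: "weighted_graph V E w \<and> n = card V \<and> k \<in> {1..n} \<and> h \<in> {1..n}"
    then interpret weighted_graph V E w by blast
    have "1 \<le> card V" "1 \<le> k" "n = card V" using asm by auto
    with ramsey_pmf_power[of k h]
    obtain D where D: "set_pmf D \<subseteq> ramsey_pairs (68 * (real k * lg (lg n))) (34 * (real k * lg (lg n))) h"
      "\<forall>v\<in>V. 1 / 8 * real n powr (- 1 / real k) \<le> measure_pmf.prob D {(U, M). v \<in> M}" by metis
    show "\<exists>D :: (('a \<Rightarrow> 'a \<Rightarrow> ennreal) \<times> 'a set) pmf.
           (\<forall>(U, M) \<in> set_pmf D.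
              ultrametric_on V U \<and> dominating V E w U \<and> M \<subseteq> V \<and>
              ramsey_hop_distortion V E w U
                (68 * (real k * lg (lg (real n)))) M (34 * (real k * lg (lg (real n)))) h) \<and>
           (\<forall>v\<in>V. measure_pmf.prob D {(U, M). v \<in> M} \<ge> 1 / 8 * real n powr (- 1 / real k))"
      
      by (intro exI[of _ D] conjI D(2)) (use D(1) in \<open>auto simp: ramsey_pairs_def\<close>)
  qed simp_all
  show "\<exists>C\<^sub>1 C\<^sub>2 :: real. 0 < C\<^sub>1 \<and> 0 < C\<^sub>2 \<and>
     (\<forall>(V :: 'a set) E w n h (\<epsilon> :: real).
        weighted_graph V E w \<and> n = card V \<and> h \<in> {1..n} \<and> 0 < \<epsilon> \<and> \<epsilon> < 1 \<longrightarrow>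
        (\<exists>D :: (('a \<Rightarrow> 'a \<Rightarrow> ennreal) \<times> 'a set) pmf.
           (\<forall>(U, M) \<in> set_pmf D.
              ultrametric_on V U \<and> dominating V E w U \<and> M \<subseteq> V \<and>
              ramsey_hop_distortion V E w U
                (C\<^sub>1 * (lg (real n) * lg (lg (real n)) / \<epsilon>)) M
                (C\<^sub>2 * (lg (real n) * lg (lg (real n)) / \<epsilon>)) h) \<and>
           (\<forall>v\<in>V. measure_pmf.prob D {(U, M). v \<in> M} \<ge> 1 - \<epsilon>)))"
  proof (rule exI[of _ 1088], rule exI[of _ 544], intro conjI allI impI)
    fix V :: "'a set" and E w and n h :: nat and \<epsilon> :: real
    assume asm: "weighted_graph V E w \<and> n = card V \<and> h \<in> {1..n} \<and> 0 < \<epsilon> \<and> \<epsilon> < 1"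
    then interpret weighted_graph V E w by blast
    have "1 \<le> card V" "n = card V" "0 < \<epsilon>" "\<epsilon> < 1" using asm by auto
    with ramsey_pmf_epsilon[OF _ _ _ refl refl, of \<epsilon> h]
    obtain D where D: "set_pmf D \<subseteq> ramsey_pairs (1088 * (lg n * lg (lg n) / \<epsilon>)) (544 * (lg n * lg (lg n) / \<epsilon>)) h"
      "\<forall>v\<in>V. 1 - \<epsilon> \<le> measure_pmf.prob D {(U, M). v \<in> M}" by metis
    show "\<exists>D :: (('a \<Rightarrow> 'a \<Rightarrow> ennreal) \<times> 'a set) pmf.
           (\<forall>(U, M) \<in> set_pmf D.
              ultrametric_on V U \<and> dominating V E w U \<and> M \<subseteq> V \<and>
              ramsey_hop_distortion V E w U
                (1088 * (lg (real n) * lg (lg (real n)) / \<epsilon>)) M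
                (544 * (lg (real n) * lg (lg (real n)) / \<epsilon>)) h) \<and>
           (\<forall>v\<in>V. measure_pmf.prob D {(U, M). v \<in> M} \<ge> 1 - \<epsilon>)"
      by (intro exI[of _ D] conjI D(2)) (use D(1) in \<open>auto simp: ramsey_pairs_def\<close>)
  qed simp_all
qed

end
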